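(* Every finite solvable group all of whose Sylow subgroups are abelian is an IYB group, i.e. it is isomorphic to the multiplicative group $(B,\cdot)$ of some finite left brace $(B,+,\cdot)$.
   Context: A left brace is a set $B$ with two binary operations $+$ and $\cdot$ such that $(B,+)$ is an abelian group, $(B,\cdot)$ is a group, and $a\cdot(b+c)+a=a\cdot b+a\cdot c$ for all $a,b,c\in B$. A group is called an IYB group if it is isomorphic to the multiplicative group of a finite left brace. *)

theory Defs
  imports "HOL-Algebra.Algebra"
begin

definition sylow_subgroup :: "('a, 'b) monoid_scheme \<Rightarrow> nat \<Rightarrow> 'a set \<Rightarrow> bool" where
  "sylow_subgroup G p P \<longleftrightarrow>
     Factorial_Ring.prime p \<and> subgroup P G \<and> card P = p ^ multiplicity p (order G)"

definition left_brace :: "'a monoid \<Rightarrow> 'a monoid \<Rightarrow> bool" where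
  "left_brace A M \<longleftrightarrow>
     comm_group A \<and> group M \<and> carrier A = carrier M \<and>
     (\<forall>a\<in>carrier M. \<forall>b\<in>carrier M. \<forall>c\<in>carrier M.
        (a \<otimes>\<^bsub>M\<^esub> (b \<otimes>\<^bsub>A\<^esub> c)) \<otimes>\<^bsub>A\<^esub> a
          = (a \<otimes>\<^bsub>M\<^esub> b) \<otimes>\<^bsub>A\<^esub> (a \<otimes>\<^bsub>M\<^esub> c))"

text \<open>IYB group: isomorphic to the multiplicative group of a finite left brace
  (the brace is taken on the same element type as the group, which is no
  restriction since any brace can be transported along a bijection).\<close>
definition IYB_group :: "'a monoid \<Rightarrow> bool" where
  "IYB_group G \<longleftrightarrow>
     (\<exists>A M :: 'a monoid. left_brace A M \<and> finite (carrier M) \<and> G \<cong> M)"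

end

theory Submission
  imports Defs
begin

text \<open>
  If \<open>c : G \<rightarrow> A\<close> is a bijective 1-cocycle into an abelian group with a \<open>G\<close>-action, then transporting
  the addition of \<open>A\<close> to \<open>G\<close> along \<open>c\<close> yields a left brace with multiplicative group \<open>G\<close>.
  Such a cocycle is assembled from one cocycle for each prime \<open>p\<close>. Let \<open>N\<close> be the largest normal
  p'-subgroup of \<open>G\<close>. Since \<open>G\<close> is solvable with abelian Sylow p-subgroups, the Sylow p-subgroup
  \<open>Q\<close> of \<open>G/N\<close> is normal, and the transfer is a cocycle \<open>G/N \<rightarrow> Q\<close> which restricts to a power map
  with exponent prime to \<open>p\<close> on \<open>Q\<close>. Hence its pullback to \<open>G\<close> kills no element of order \<open>p\<close>. The
  product of these cocycles over all \<open>p\<close> is injective, because a nontrivial kernel would contain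
  an element of prime order, and it is bijective because the product of the groups \<open>Q\<close> has order \<open>|G|\<close>.
\<close>

section \<open>Elements of p-power order and elements of order prime to p\<close>

definition p_primary :: "('a, 'b) monoid_scheme \<Rightarrow> nat \<Rightarrow> 'a set \<Rightarrow> bool" where
  "p_primary G p H \<longleftrightarrow> (\<forall>x\<in>H. \<exists>k::nat. x [^]\<^bsub>G\<^esub> (p ^ k) = \<one>\<^bsub>G\<^esub>)"

text \<open>For a prime \<open>p\<close> and a finite subgroup this is the p'-condition, by Cauchy's
  theorem. The elementwise form can be checked on preimages without counting.\<close>

definition p_torsion_free :: "('a, 'b) monoid_scheme \<Rightarrow> nat \<Rightarrow> 'a set \<Rightarrow> bool" where
  "p_torsion_free G p H \<longleftrightarrow> (\<forall>x\<in>H. x [^]\<^bsub>G\<^esub> p = \<one>\<^bsub>G\<^esub> \<longrightarrow> x = \<one>\<^bsub>G\<^esub>)"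

context group
begin

lemma inv_mult_cancel:
  assumes "g \<in> carrier G" "a \<in> carrier G"
  shows "inv g \<otimes> (g \<otimes> a) = a" "g \<otimes> (inv g \<otimes> a) = a"
  using assms by (simp_all flip: m_assoc)

lemma pow_coprime_eq_one:
  assumes x: "x \<in> carrier G" and "x [^] (m::nat) = \<one>" "x [^] (n::nat) = \<one>" "coprime m n"
  shows "x = \<one>"
proof -
  have "ord x dvd m" "ord x dvd n" using assms pow_eq_id by auto
  then have "ord x = 1" using \<open>coprime m n\<close> coprime_common_divisor_nat by blast
  then show ?thesis using x ord_eq_1 by blast
qed

lemma conj_pow:
  assumes "g \<in> carrier G" "x \<in> carrier G"
  shows "(g \<otimes> x \<otimes> inv g) [^] (n::nat) = g \<otimes> x [^] n \<otimes> inv g"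
proof (induction n)
  case (Suc n)
  then show ?case using assms by (simp add: m_assoc inv_mult_cancel)
qed (use assms in simp)

text \<open>\<open>z\<close> is the commutator of \<open>x\<close> and \<open>y\<close>. Since it
  commutes with \<open>x\<close>, each passage of a factor \<open>x\<close> across \<open>y\<close>
  splits off one copy of \<open>z\<close>. If \<open>x [^] n = \<one>\<close>, this forces
  \<open>z [^] n = \<one>\<close>.\<close>

lemma pow_commute_twisted:
  assumes "x \<in> carrier G" "y \<in> carrier G" "z \<in> carrier G"
    and "x \<otimes> y = z \<otimes> (y \<otimes> x)" and "x \<otimes> z = z \<otimes> x"
  shows "x [^] (n::nat) \<otimes> y = z [^] n \<otimes> (y \<otimes> x [^] n)"
proof (induction n)
  case (Suc n)
  have xz: "x [^] n \<otimes> z = z \<otimes> x [^] n"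
  proof (induction n)
    case (Suc n)
    then show ?case using assms by simp (metis m_assoc nat_pow_closed)
  qed (use assms in simp)
  have "x [^] Suc n \<otimes> y = x [^] n \<otimes> (z \<otimes> (y \<otimes> x))" using assms by (simp add: m_assoc)
  also have "\<dots> = z \<otimes> (x [^] n \<otimes> y) \<otimes> x" using assms xz by (metis m_assoc m_closed nat_pow_closed)
  also have "\<dots> = (z \<otimes> z [^] n) \<otimes> (y \<otimes> (x [^] n \<otimes> x))" using assms Suc by (simp add: m_assoc)
  also have "z \<otimes> z [^] n = z [^] Suc n" using assms by (metis nat_pow_Suc2)
  finally show ?case by simp
qed (use assms in simp)

lemma p_primary_if_card:
  assumes "subgroup H G" "card H = p ^ k"
  shows "p_primary G p H"
  unfolding p_primary_def
proof
  fix x assume x: "x \<in> H"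
  interpret H: group "G\<lparr>carrier := H\<rparr>" using assms subgroup_imp_group by blast
  have "x [^] (p ^ k) = \<one>"
    using H.pow_order_eq_1[of x] x assms(2) by (simp add: order_def nat_pow_consistent[symmetric])
  then show "\<exists>k. x [^] p ^ k = \<one>" by blast
qed

text \<open>Another prime \<open>q\<close> dividing the order would give a subgroup of order
  \<open>q\<close>, whose elements are annihilated by the coprime exponents \<open>q\<close> and a
  power of \<open>p\<close>.\<close>

lemma card_p_primary:
  assumes "subgroup H G" "finite H" "Factorial_Ring.prime p" "p_primary G p H"
  shows "\<exists>k. card H = p ^ k"
proof (rule ccontr)
  assume non: "\<nexists>k. card H = p ^ k"
  interpret H: group "G\<lparr>carrier := H\<rparr>" using assms subgroup_imp_group by blast
  have H0: "card H \<noteq> 0" using assms(2) subgroup.one_closed[OF assms(1)] by auto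
  have "\<exists>q. Factorial_Ring.prime q \<and> q \<noteq> p \<and> q dvd card H"
  proof (rule ccontr)
    assume a: "\<not> ?thesis"
    have np: "\<not> is_unit p" using assms(3) by auto
    obtain m where m: "card H = p ^ multiplicity p (card H) * m" "\<not> p dvd m"
      using multiplicity_decompose'[OF H0 np] by metis
    have "m = 1"
    proof (rule ccontr)
      assume "m \<noteq> 1"
      then obtain q where "Factorial_Ring.prime q" "q dvd m" using prime_factor_nat by blast
      then show False using a m by (metis dvd_mult)
    qed
    then show False using non m by (metis mult.right_neutral)
  qed
  then obtain q where q: "Factorial_Ring.prime q" "q \<noteq> p" "q dvd card H" by blast
  \<comment> \<open>With exponent 1 the existence part of Sylow's theorem is Cauchy's
    theorem.\<close>
  obtain l where "order (G\<lparr>carrier := H\<rparr>) = q ^ 1 * l" using q(3) by (auto simp: order_def)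
  from sylow_thm[OF q(1) H.is_group this] assms(2) obtain K where
    K: "subgroup K (G\<lparr>carrier := H\<rparr>)" "card K = q ^ 1" by auto
  have KG: "subgroup K G" using K(1) assms(1) incl_subgroup by blast
  have KH: "K \<subseteq> H" using subgroup.subset[OF K(1)] by simp
  interpret K: group "G\<lparr>carrier := K\<rparr>" using KG subgroup_imp_group by blast
  have "x = \<one>" if x: "x \<in> K" for x
  proof -
    obtain k where "x [^] (p ^ k) = \<one>" using x KH assms(4) by (auto simp: p_primary_def)
    moreover have "x [^] q = \<one>"
      using K.pow_order_eq_1[of x] x K(2) by (simp add: order_def nat_pow_consistent[symmetric])
    moreover have "coprime (p ^ k) q" using q assms(3) by (simp add: primes_coprime)
    ultimately show ?thesis using pow_coprime_eq_one x subgroup.mem_carrier[OF KG] by blast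
  qed
  then have "K \<subseteq> {\<one>}" by blast
  then have "card K \<le> 1" using card_mono[of "{\<one>}" K] by simp
  then show False using K(2) prime_gt_1_nat[OF q(1)] by simp
qed

lemma p_torsion_free_pow_prime_power:
  assumes "subgroup H G" "p_torsion_free G p H" "x \<in> H" "x [^] (p ^ k) = \<one>"
  shows "x = \<one>"
  using assms(4)
proof (induction k)
  case 0
  then show ?case using assms subgroup.mem_carrier by fastforce
next
  case (Suc k)
  have x: "x \<in> carrier G" using assms subgroup.mem_carrier by fastforce
  have xk: "x [^] (p ^ k) \<in> H" using subgroup_int_pow_closed[OF assms(1,3)] by (metis int_pow_int)
  have "(x [^] (p ^ k)) [^] p = \<one>" using Suc.prems x by (simp add: nat_pow_pow mult.commute)
  then have "x [^] (p ^ k) = \<one>" using assms(2) xk by (auto simp: p_torsion_free_def)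
  then show ?case by (rule Suc.IH)
qed

text \<open>Modulo \<open>Q\<close> a product \<open>q \<otimes> h\<close> coincides with
  \<open>h\<close>, so some p-power exponent moves it into \<open>Q\<close> and a further one kills
  it.\<close>

lemma p_primary_set_mult:
  assumes "Q \<lhd> G" "subgroup H G" "p_primary G p Q" "p_primary G p H"
  shows "p_primary G p (Q <#> H)"
  unfolding p_primary_def
proof
  interpret Q: normal Q G by fact
  fix x assume "x \<in> Q <#> H"
  then obtain q h where x: "x = q \<otimes> h" "q \<in> Q" "h \<in> H" by (auto simp: set_mult_def)
  have h: "h \<in> carrier G" using x assms(2) subgroup.mem_carrier by fastforce
  have q: "q \<in> carrier G" using x Q.subset by blast
  obtain k where k: "h [^] (p ^ k) = \<one>" using x assms(4) by (auto simp: p_primary_def)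
  have Qx: "Q #> x = Q #> h" using x h Q.subset Q.rcos_const[OF is_group x(2)]
    by (metis coset_mult_assoc q)
  have "Q #> (x [^] (p ^ k)) = (Q #> x) [^]\<^bsub>G Mod Q\<^esub> (p ^ k)"
    using Q.FactGroup_pow x h q by simp
  also have "\<dots> = Q #> (h [^] (p ^ k))" using Q.FactGroup_pow h Qx by simp
  also have "\<dots> = Q" using k Q.subset by simp
  finally have "x [^] (p ^ k) \<in> Q"
    using coset_join1 x h q Q.subgroup_axioms Q.subset by (metis m_closed nat_pow_closed)
  then obtain l where "(x [^] (p ^ k)) [^] (p ^ l) = \<one>" using assms(3) by (auto simp: p_primary_def)
  then have "x [^] (p ^ (k + l)) = \<one>" using x h q by (simp add: nat_pow_pow power_add)
  then show "\<exists>k. x [^] p ^ k = \<one>" by blast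
qed

lemma subset_set_mult:
  assumes "subgroup Q G" "subgroup H G"
  shows "Q \<subseteq> Q <#> H" "H \<subseteq> Q <#> H"
proof -
  show "Q \<subseteq> Q <#> H"
    using assms subgroup.one_closed[OF assms(2)] subgroup.mem_carrier[OF assms(1)]
    by (force simp: set_mult_def)
  show "H \<subseteq> Q <#> H"
    using assms subgroup.one_closed[OF assms(1)] subgroup.mem_carrier[OF assms(2)]
    by (force simp: set_mult_def)
qed

section \<open>Centralizers of normal p-subgroups and normality of abelian Sylow subgroups\<close>

definition centralizer_of :: "'a set \<Rightarrow> 'a set" where
  "centralizer_of Q = {g \<in> carrier G. \<forall>q\<in>Q. g \<otimes> q = q \<otimes> g}"

lemma centralizer_of_normal:
  assumes "Q \<lhd> G"
  shows "centralizer_of Q \<lhd> G"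
proof (rule normal_invI)
  interpret Q: normal Q G by fact
  have Qc: "q \<in> carrier G" if "q \<in> Q" for q using that Q.subset by blast
  show "subgroup (centralizer_of Q) G"
  proof (rule subgroupI)
    show "centralizer_of Q \<subseteq> carrier G" by (auto simp: centralizer_of_def)
    show "centralizer_of Q \<noteq> {}" using Qc by (auto simp: centralizer_of_def intro!: exI[of _ \<one>])
  next
    fix a assume a: "a \<in> centralizer_of Q"
    then have ac: "a \<in> carrier G" by (simp add: centralizer_of_def)
    have "inv a \<otimes> q = q \<otimes> inv a" if q: "q \<in> Q" for q
    proof -
      have "a \<otimes> q = q \<otimes> a" using a q by (simp add: centralizer_of_def)
      then show ?thesis using ac Qc[OF q] by (metis inv_closed inv_solve_left inv_solve_right m_assoc m_closed)
    qed
    then show "inv a \<in> centralizer_of Q" using ac by (simp add: centralizer_of_def)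
  next
    fix a b assume a: "a \<in> centralizer_of Q" and b: "b \<in> centralizer_of Q"
    then have c: "a \<in> carrier G" "b \<in> carrier G" by (auto simp: centralizer_of_def)
    have "a \<otimes> b \<otimes> q = q \<otimes> (a \<otimes> b)" if q: "q \<in> Q" for q
    proof -
      have "a \<otimes> b \<otimes> q = a \<otimes> (q \<otimes> b)" using b q c Qc[OF q] by (simp add: centralizer_of_def m_assoc)
      also have "\<dots> = (a \<otimes> q) \<otimes> b" using c Qc[OF q] by (simp add: m_assoc)
      also have "\<dots> = (q \<otimes> a) \<otimes> b" using a q by (simp add: centralizer_of_def)
      finally show ?thesis using c Qc[OF q] by (simp add: m_assoc)
    qed
    then show "a \<otimes> b \<in> centralizer_of Q" using c by (simp add: centralizer_of_def)
  qed
  fix g c assume g: "g \<in> carrier G" and c: "c \<in> centralizer_of Q"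
  have cc: "c \<in> carrier G" using c by (simp add: centralizer_of_def)
  have "g \<otimes> c \<otimes> inv g \<otimes> q = q \<otimes> (g \<otimes> c \<otimes> inv g)" if q: "q \<in> Q" for q
  proof -
    have r: "inv g \<otimes> q \<otimes> g \<in> Q" using Q.inv_op_closed1 g q by blast
    have "g \<otimes> c \<otimes> inv g \<otimes> q = g \<otimes> (c \<otimes> (inv g \<otimes> q \<otimes> g)) \<otimes> inv g"
      using g cc Qc[OF q] by (simp add: m_assoc)
    also have "\<dots> = g \<otimes> ((inv g \<otimes> q \<otimes> g) \<otimes> c) \<otimes> inv g"
      using c r by (simp add: centralizer_of_def)
    also have "\<dots> = q \<otimes> (g \<otimes> c \<otimes> inv g)"
      using g cc Qc[OF q] by (simp add: m_assoc inv_mult_cancel)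
    finally show ?thesis .
  qed
  then show "g \<otimes> c \<otimes> inv g \<in> centralizer_of Q" using g cc by (simp add: centralizer_of_def)
qed

text \<open>A commutator of a p'-element with any element of \<open>E\<close> lies in \<open>Q\<close>, which centralizes \<open>E\<close>, so it
  has both p'-order and p-power order. Hence the p'-elements of \<open>E\<close> form a normal subgroup.\<close>

lemma normal_class_two_p_primary:
  assumes fin: "finite (carrier G)" and p: "Factorial_Ring.prime p"
    and no: "\<And>N. N \<lhd> G \<Longrightarrow> p_torsion_free G p N \<Longrightarrow> N = {\<one>}"
    and Q: "p_primary G p Q" and Qc: "Q \<subseteq> carrier G"
    and E: "E \<lhd> G" "E \<subseteq> centralizer_of Q"
    and comm: "\<And>x y. x \<in> E \<Longrightarrow> y \<in> E \<Longrightarrow> x \<otimes> y \<otimes> inv x \<otimes> inv y \<in> Q"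
  shows "p_primary G p E"
proof -
  interpret E: normal E G by fact
  have Ec: "x \<in> carrier G" if "x \<in> E" for x using that E.subset by blast
  \<comment> \<open>The p'-elements of \<open>E\<close>. They turn out to be central in
    \<open>E\<close>, so that products of them are p'-elements again.\<close>
  define S where "S = {x \<in> E. \<exists>n::nat. coprime n p \<and> x [^] n = \<one>}"
  have comm_S: "x \<otimes> y = y \<otimes> x" if x: "x \<in> S" and y: "y \<in> E" for x y
  proof -
    obtain n :: nat where n: "coprime n p" "x [^] n = \<one>" and xE: "x \<in> E" using x by (auto simp: S_def)
    define z where "z = x \<otimes> y \<otimes> inv x \<otimes> inv y"
    have zQ: "z \<in> Q" using comm xE y z_def by blast
    then have zc: "z \<in> carrier G" using Qc by blast
    have eq: "x \<otimes> y = z \<otimes> (y \<otimes> x)"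
      unfolding z_def using Ec[OF xE] Ec[OF y] by (simp add: m_assoc inv_mult_cancel)
    have "x \<otimes> z = z \<otimes> x" using xE E(2) zQ by (auto simp: centralizer_of_def)
    from pow_commute_twisted[OF Ec[OF xE] Ec[OF y] zc eq this, of n]
    have "z [^] n = \<one>" using n Ec[OF y] zc by simp
    moreover obtain k where "z [^] (p ^ k) = \<one>" using Q zQ by (auto simp: p_primary_def)
    ultimately have "z = \<one>" using pow_coprime_eq_one[OF zc] n(1) coprime_power_right_iff by blast
    then show ?thesis using eq Ec[OF xE] Ec[OF y] by simp
  qed
  have "S \<lhd> G"
  proof (rule normal_invI)
    show "subgroup S G"
    proof (rule subgroupI)
      show "S \<subseteq> carrier G" using Ec by (auto simp: S_def)
      show "S \<noteq> {}" using E.one_closed by (auto simp: S_def intro!: exI[of _ \<one>] exI[of _ 1])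
    next
      fix a assume "a \<in> S"
      then show "inv a \<in> S" using Ec by (auto simp: S_def nat_pow_inv)
    next
      fix a b assume a: "a \<in> S" and b: "b \<in> S"
      obtain n :: nat where n: "coprime n p" "a [^] n = \<one>" "a \<in> E" using a by (auto simp: S_def)
      obtain m :: nat where m: "coprime m p" "b [^] m = \<one>" "b \<in> E" using b by (auto simp: S_def)
      have ab: "a \<otimes> b = b \<otimes> a" using comm_S a m by blast
      have "(a \<otimes> b) [^] (n * m) = a [^] (n * m) \<otimes> b [^] (n * m)"
        using pow_mult_distrib[OF ab] Ec n m by blast
      also have "\<dots> = (a [^] n) [^] m \<otimes> (b [^] m) [^] n"
        using Ec[OF n(3)] Ec[OF m(3)] by (simp only: nat_pow_pow mult.commute)
      also have "\<dots> = \<one>" using n m by simp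
      finally show "a \<otimes> b \<in> S" using n m by (auto simp: S_def intro!: exI[of _ "n * m"])
    qed
    fix g x assume "g \<in> carrier G" "x \<in> S"
    then show "g \<otimes> x \<otimes> inv g \<in> S"
      using Ec E.inv_op_closed2 by (auto simp: S_def conj_pow)
  qed
  moreover have "p_torsion_free G p S"
    unfolding p_torsion_free_def S_def using pow_coprime_eq_one Ec by blast
  ultimately have S1: "S = {\<one>}" by (rule no)
  show ?thesis
    unfolding p_primary_def
  proof
    fix x assume x: "x \<in> E"
    have "ord x \<noteq> 0" using Ec[OF x] fin ord_ge_1 by fastforce
    moreover have "\<not> is_unit p" using p by auto
    ultimately obtain m where m: "ord x = p ^ multiplicity p (ord x) * m" "\<not> p dvd m"
      using multiplicity_decompose' by metis
    \<comment> \<open>Raising \<open>x\<close> to the p-part of its order leaves an element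
      annihilated by \<open>m\<close>, hence a member of the trivial group \<open>S\<close>.\<close>
    have "coprime m p" using m(2) p by (metis coprime_commute prime_imp_coprime)
    moreover have "(x [^] (p ^ multiplicity p (ord x))) [^] m = \<one>"
      using m(1) Ec[OF x] by (simp add: nat_pow_pow flip: m(1))
    moreover have "x [^] (p ^ multiplicity p (ord x)) \<in> E"
      using subgroup_int_pow_closed[OF E.subgroup_axioms x] by (metis int_pow_int)
    ultimately have "x [^] (p ^ multiplicity p (ord x)) \<in> S" by (auto simp: S_def)
    then show "\<exists>k. x [^] p ^ k = \<one>" using S1 by blast
  qed
qed

text \<open>Orders are bounded by that of \<open>G\<close>, and the trivial subgroup qualifies. This
  provides both the largest normal p-subgroup and the largest normal p'-subgroup, with orders
  compared in place of inclusions.\<close>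

lemma ex_max_card_normal:
  assumes "finite (carrier G)" "T {\<one>}"
  shows "\<exists>N. N \<lhd> G \<and> T N \<and> (\<forall>R. R \<lhd> G \<longrightarrow> T R \<longrightarrow> card R \<le> card N)"
proof -
  have "\<forall>R. R \<lhd> G \<and> T R \<longrightarrow> card R < Suc (card (carrier G))"
    using assms(1) card_mono normal_imp_subgroup subgroup.subset by (metis less_Suc_eq_le)
  from ex_has_greatest_nat[of "\<lambda>R. R \<lhd> G \<and> T R", OF _ this] assms(2) one_is_normal
  show ?thesis by blast
qed

lemma commutator_in_derived:
  assumes "x \<in> D" "y \<in> D"
  shows "x \<otimes> y \<otimes> inv x \<otimes> inv y \<in> derived G D"
  unfolding derived_def using assms by (intro generate.incl) blast

lemma normal_derived_seq: "(derived G ^^ n) (carrier G) \<lhd> G"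
proof (induction n)
  case 0
  then show ?case using normal_invI[OF subgroup_self] by simp
next
  case (Suc n)
  then show ?case using derived_is_normal by simp
qed

text \<open>The abelian-Sylow case of the Hall--Higman lemma: the centralizer of the largest normal
  p-subgroup \<open>Q\<close> lies in \<open>Q\<close>, but it also contains every abelian Sylow p-subgroup.\<close>

lemma abelian_sylow_normal:
  assumes fin: "finite (carrier G)" and p: "Factorial_Ring.prime p" and sol: "solvable G"
    and no: "\<And>N. N \<lhd> G \<Longrightarrow> p_torsion_free G p N \<Longrightarrow> N = {\<one>}"
    and P: "sylow_subgroup G p P" and com: "comm_group (G\<lparr>carrier := P\<rparr>)"
  shows "P \<lhd> G"
proof -
  have sP: "subgroup P G" and cP: "card P = p ^ multiplicity p (order G)"
    using P by (auto simp: sylow_subgroup_def)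
  have finS: "finite H" if "subgroup H G" for H using that fin by (meson finite_subset subgroup.subset)
  have pP: "p_primary G p P" using p_primary_if_card sP cP by blast
  obtain Q where Q: "Q \<lhd> G" "p_primary G p Q"
    and Qmax: "\<And>R. R \<lhd> G \<Longrightarrow> p_primary G p R \<Longrightarrow> card R \<le> card Q"
    using ex_max_card_normal[OF fin, of "p_primary G p"] by (auto simp: p_primary_def)
  interpret Q: normal Q G by fact
  \<comment> \<open>\<open>Q <#> E\<close> is again a normal p-subgroup and contains
    \<open>Q\<close>, so maximality of the order makes it equal to \<open>Q\<close>.\<close>
  have abs: "E \<subseteq> Q" if E: "E \<lhd> G" "p_primary G p E" for E
  proof -
    have sE: "subgroup E G" using E normal_imp_subgroup by blast
    have QE: "Q <#> E \<lhd> G" using normal_subgroup_set_mult_closed Q E by blast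
    have "card (Q <#> E) \<le> card Q" using Qmax QE p_primary_set_mult Q E sE by blast
    moreover have "finite (Q <#> E)" using QE finS normal_imp_subgroup by blast
    ultimately have "Q = Q <#> E"
      using card_seteq subset_set_mult(1)[OF Q.subgroup_axioms sE] by blast
    then show ?thesis using subset_set_mult(2)[OF Q.subgroup_axioms sE] by simp
  qed
  \<comment> \<open>\<open>Q <#> P\<close> is a p-subgroup, so its order is at most the p-part of
    the order of \<open>G\<close>, which \<open>P\<close> already attains.\<close>
  have QP: "Q \<subseteq> P"
  proof -
    have QPs: "subgroup (Q <#> P) G" using mult_norm_subgroup Q sP by blast
    obtain k where k: "card (Q <#> P) = p ^ k"
      using card_p_primary[OF QPs finS[OF QPs] p] p_primary_set_mult Q sP pP by blast
    have "p ^ k dvd order G" using lagrange[OF QPs] k by (metis dvd_triv_right)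
    moreover have "order G \<noteq> 0" using fin order_gt_0_iff_finite by auto
    moreover have "\<not> is_unit p" using p by auto
    ultimately have "k \<le> multiplicity p (order G)" by (simp add: power_dvd_iff_le_multiplicity)
    then have "card (Q <#> P) \<le> card P"
      using k cP p prime_gt_0_nat by (simp add: power_increasing Suc_leI)
    then have "P = Q <#> P"
      using card_seteq[OF finS[OF QPs] subset_set_mult(2)[OF Q.subgroup_axioms sP]] by blast
    then show ?thesis using subset_set_mult(1)[OF Q.subgroup_axioms sP] by simp
  qed
  define C where "C = centralizer_of Q"
  have C: "C \<lhd> G" unfolding C_def using centralizer_of_normal Q by blast
  have PC: "P \<subseteq> C"
  proof
    fix x assume x: "x \<in> P"
    have "x \<otimes> q = q \<otimes> x" if "q \<in> Q" for q
      using comm_groupE(4)[OF com, of x q] x that QP by auto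
    then show "x \<in> C" using x subgroup.mem_carrier[OF sP] by (auto simp: C_def centralizer_of_def)
  qed
  \<comment> \<open>Commutators of the intersection at level \<open>n\<close> lie in the one at
    level \<open>Suc n\<close>, hence in \<open>Q\<close>. The intersection at level
    \<open>n\<close> also centralizes \<open>Q\<close>, so it is a normal p-subgroup and is absorbed
    by \<open>Q\<close>.\<close>
  have step: "C \<inter> (derived G ^^ n) (carrier G) \<subseteq> Q"
    if "C \<inter> (derived G ^^ Suc n) (carrier G) \<subseteq> Q" for n
  proof (rule abs)
    let ?D = "(derived G ^^ n) (carrier G)"
    show E: "C \<inter> ?D \<lhd> G" using normal_subgroup_intersect C normal_derived_seq by blast
    show "p_primary G p (C \<inter> ?D)"
    proof (rule normal_class_two_p_primary[OF fin p no Q(2) Q.subset E])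
      show "C \<inter> ?D \<subseteq> centralizer_of Q" by (auto simp: C_def)
      fix x y assume x: "x \<in> C \<inter> ?D" and y: "y \<in> C \<inter> ?D"
      have "x \<otimes> y \<otimes> inv x \<otimes> inv y \<in> derived G ?D"
        using commutator_in_derived[OF IntD2[OF x] IntD2[OF y]] .
      moreover have "x \<otimes> y \<otimes> inv x \<otimes> inv y \<in> C"
        using x y normal_imp_subgroup[OF C] by (simp add: subgroup.m_closed subgroup.m_inv_closed)
      ultimately show "x \<otimes> y \<otimes> inv x \<otimes> inv y \<in> Q" using that by auto
    qed
  qed
  obtain n where n: "(derived G ^^ n) (carrier G) = {\<one>}"
    using sol solvable_iff_trivial_derived_seq by blast
  have "C \<inter> (derived G ^^ n) (carrier G) \<subseteq> Q" using n Q.one_closed by auto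
  \<comment> \<open>The induction runs backwards, from the trivial term of the derived series up to
    the whole group at index 0.\<close>
  then have "C \<inter> (derived G ^^ 0) (carrier G) \<subseteq> Q"
  proof (induction n)
    case (Suc n)
    then show ?case using step by blast
  qed
  then have "C \<subseteq> Q" using normal_imp_subgroup[OF C] subgroup.subset by fastforce
  then have "P = Q" using PC QP by blast
  then show ?thesis using Q by simp
qed

end

section \<open>Cocycles attached to a single prime\<close>

text \<open>The cardinality clause makes the groups for the various primes multiply up to the order
  of \<open>G\<close>. The last clause says that \<open>c\<close> kills no element of order
  \<open>p\<close>. Injectivity of \<open>a g\<close> lets \<open>a g x = \<one>\<close> be
  cancelled to \<open>x = \<one>\<close>.\<close>

definition prime_cocycle ::
  "('a, 'b) monoid_scheme \<Rightarrow> nat \<Rightarrow> ('c, 'd) monoid_scheme \<Rightarrow> ('a \<Rightarrow> 'c \<Rightarrow> 'c) \<Rightarrow> ('a \<Rightarrow> 'c) \<Rightarrow> bool"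
where
  "prime_cocycle G p A a c \<longleftrightarrow>
    comm_group A \<and> card (carrier A) = p ^ multiplicity p (order G) \<and>
    (\<forall>g\<in>carrier G. a g \<in> hom A A \<and> inj_on (a g) (carrier A)) \<and> c \<in> carrier G \<rightarrow> carrier A \<and>
    (\<forall>g\<in>carrier G. \<forall>h\<in>carrier G. c (g \<otimes>\<^bsub>G\<^esub> h) = c g \<otimes>\<^bsub>A\<^esub> a g (c h)) \<and>
    (\<forall>g\<in>carrier G. c g = \<one>\<^bsub>A\<^esub> \<longrightarrow> g [^]\<^bsub>G\<^esub> p = \<one>\<^bsub>G\<^esub> \<longrightarrow> g = \<one>\<^bsub>G\<^esub>)"

text \<open>Members of \<open>hom\<close> preserve products only, so the unit has its own premise.
  It settles the empty product and infinite index sets, where \<open>finprod\<close> is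
  \<open>\<one>\<close> by convention.\<close>

lemma (in comm_monoid) finprod_hom:
  assumes h: "h \<in> hom G G" "h \<one> = \<one>" and f: "f \<in> A \<rightarrow> carrier G"
  shows "finprod G (\<lambda>x. h (f x)) A = h (finprod G f A)"
  using f
proof (induction A rule: infinite_finite_induct)
  case (insert a A)
  then have "(\<lambda>x. h (f x)) \<in> A \<rightarrow> carrier G" "h (f a) \<in> carrier G"
    using h by (auto simp: hom_def Pi_iff)
  then show ?case using insert h by (simp add: hom_mult Pi_iff)
qed (use h in auto)

context group
begin

lemma conj_mult:
  assumes "g \<in> carrier G" "x \<in> carrier G" "y \<in> carrier G"
  shows "g \<otimes> (x \<otimes> y) \<otimes> inv g = (g \<otimes> x \<otimes> inv g) \<otimes> (g \<otimes> y \<otimes> inv g)"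
  using assms by (simp add: m_assoc inv_mult_cancel)

text \<open>With a transversal \<open>t\<close>, the transfer product of the elements \<open>g t(U) t(gU)\<^sup>-\<^sup>1\<close> over all
  cosets \<open>U\<close> of \<open>Q\<close> is a 1-cocycle with values in \<open>Q\<close>.\<close>

lemma ex_transfer_cocycle:
  assumes Q: "Q \<lhd> G" and com: "comm_group (G\<lparr>carrier := Q\<rparr>)"
  shows "\<exists>c. c \<in> carrier G \<rightarrow> Q \<and>
    (\<forall>g\<in>carrier G. \<forall>h\<in>carrier G. c (g \<otimes> h) = c g \<otimes> (g \<otimes> c h \<otimes> inv g)) \<and>
    (\<forall>g\<in>Q. c g = g [^] card (rcosets Q))"
proof -
  interpret Q: normal Q G by fact
  interpret A: comm_group "G\<lparr>carrier := Q\<rparr>" by fact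
  interpret F: group "G Mod Q" by (rule Q.factorgroup_is_group)
  let ?R = "rcosets Q"
  have carF: "carrier (G Mod Q) = ?R" by (simp add: FactGroup_def)
  define t where "t U = (SOME x. x \<in> U)" for U :: "'a set"
  have t: "t U \<in> carrier G" "Q #> t U = U" if U: "U \<in> ?R" for U
  proof -
    obtain x where x: "x \<in> carrier G" "U = Q #> x" using U by (auto simp: RCOSETS_def)
    have "x \<in> U" using x rcos_self Q.subgroup_axioms by blast
    then have tU: "t U \<in> Q #> x" unfolding t_def using x by (metis someI_ex)
    then show "t U \<in> carrier G" using x Q.elemrcos_carrier is_group by blast
    show "Q #> t U = U" using repr_independence[OF tU x(1) Q.subgroup_axioms] x by simp
  qed
  \<comment> \<open>Left translation by \<open>g\<close> on the cosets, written as multiplication in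
    the quotient group; it permutes the cosets.\<close>
  define l where "l g U = (Q #> g) <#> U" for g U
  have lR: "l g U \<in> ?R" if "g \<in> carrier G" "U \<in> ?R" for g U
    using that Q.setmult_closed rcosetsI Q.subset unfolding l_def by blast
  have l_inj: "inj_on (l g) ?R" "l g ` ?R = ?R" if g: "g \<in> carrier G" for g
  proof -
    have gF: "Q #> g \<in> carrier (G Mod Q)" using g carF rcosetsI Q.subset by blast
    show "inj_on (l g) ?R" using F.inj_on_cmult[OF gF] by (simp add: l_def[abs_def] carF)
    show "l g ` ?R = ?R" using F.surj_const_mult[OF gF] by (simp add: l_def[abs_def] carF)
  qed
  have l_mult: "l (g \<otimes> h) U = l g (l h U)" if g: "g \<in> carrier G" "h \<in> carrier G" "U \<in> ?R" for g h U
  proof -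
    have "Q #> g \<in> ?R" "Q #> h \<in> ?R" using g rcosetsI Q.subset by blast+
    then show ?thesis using g Q.rcos_sum Q.rcosets_assoc unfolding l_def by metis
  qed
  \<comment> \<open>\<open>t (l g U)\<close> represents the coset of \<open>g \<otimes> t U\<close>,
    so this factor lies in \<open>Q\<close>.\<close>
  define f where "f g U = g \<otimes> t U \<otimes> inv (t (l g U))" for g U
  have fQ: "f g U \<in> Q" if g: "g \<in> carrier G" and U: "U \<in> ?R" for g U
  proof -
    have "Q #> (g \<otimes> t U) = (Q #> g) <#> (Q #> t U)" using Q.rcos_sum[OF g t(1)[OF U]] by (rule sym)
    also have "\<dots> = l g U" using t[OF U] by (simp add: l_def)
    also have "\<dots> = Q #> t (l g U)" using t lR g U by simp
    finally have "g \<otimes> t U \<in> Q #> t (l g U)" using rcos_self[OF _ Q.subgroup_axioms] g t[OF U]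
      by (metis m_closed)
    then show ?thesis unfolding f_def
      using Q.rcos_module_imp[OF is_group] t(1)[OF lR[OF g U]] by blast
  qed
  define c where "c g = finprod (G\<lparr>carrier := Q\<rparr>) (f g) ?R" for g
  have cQ: "c g \<in> Q" if "g \<in> carrier G" for g
    using A.finprod_closed[of "f g" ?R] fQ that by (auto simp: c_def)
  have "c (g \<otimes> h) = c g \<otimes> (g \<otimes> c h \<otimes> inv g)" if g: "g \<in> carrier G" and h: "h \<in> carrier G" for g h
  proof -
    let ?k = "\<lambda>x. g \<otimes> x \<otimes> inv g"
    have k: "?k \<in> hom (G\<lparr>carrier := Q\<rparr>) (G\<lparr>carrier := Q\<rparr>)"
      using g Q.inv_op_closed2 Q.subset by (auto simp: hom_def conj_mult subset_eq)
    \<comment> \<open>Inserting \<open>inv (t (l h U)) \<otimes> inv g \<otimes> g \<otimes> t (l h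
      U)\<close> splits the factor in two. Both parts lie in the abelian group \<open>Q\<close> and
      may be exchanged.\<close>
    have feq: "f (g \<otimes> h) U = f g (l h U) \<otimes> ?k (f h U)" if U: "U \<in> ?R" for U
    proof -
      have k1: "?k (f h U) \<in> Q" using fQ[OF h U] g Q.inv_op_closed2 by blast
      have f1: "f g (l h U) \<in> Q" using fQ[OF g lR[OF h U]] .
      have "f (g \<otimes> h) U = ?k (f h U) \<otimes> f g (l h U)"
        unfolding f_def l_mult[OF g h U]
        using g h t(1)[OF U] t(1)[OF lR[OF h U]] t(1)[OF lR[OF g lR[OF h U]]]
        by (simp add: m_assoc inv_mult_cancel)
      also have "\<dots> = f g (l h U) \<otimes> ?k (f h U)" using A.m_comm k1 f1 by simp
      finally show ?thesis .
    qed
    have fm: "(\<lambda>U. f g (l h U)) \<in> ?R \<rightarrow> Q" "(\<lambda>U. ?k (f h U)) \<in> ?R \<rightarrow> Q" "f h \<in> ?R \<rightarrow> Q" "f g \<in> ?R \<rightarrow> Q"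
      using fQ lR g h Q.inv_op_closed2 by auto
    have "c (g \<otimes> h) = finprod (G\<lparr>carrier := Q\<rparr>) (\<lambda>U. f g (l h U) \<otimes> ?k (f h U)) ?R"
      unfolding c_def by (rule A.finprod_cong') (use feq fm in \<open>auto simp: Pi_iff\<close>)
    also have "\<dots> = finprod (G\<lparr>carrier := Q\<rparr>) (\<lambda>U. f g (l h U)) ?R
        \<otimes> finprod (G\<lparr>carrier := Q\<rparr>) (\<lambda>U. ?k (f h U)) ?R"
      using A.finprod_multf[of "\<lambda>U. f g (l h U)" ?R "\<lambda>U. ?k (f h U)"] fm by simp
    \<comment> \<open>\<open>l h\<close> permutes the cosets, so the shift of the index does not
      change the product.\<close>
    also have "finprod (G\<lparr>carrier := Q\<rparr>) (\<lambda>U. f g (l h U)) ?R = c g"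
      using A.finprod_reindex[of "f g" "l h" ?R] l_inj[OF h] fm by (simp add: c_def)
    also have "finprod (G\<lparr>carrier := Q\<rparr>) (\<lambda>U. ?k (f h U)) ?R = ?k (c h)"
      using A.finprod_hom[OF k, of "f h" ?R] g fm by (simp add: c_def)
    finally show ?thesis .
  qed
  moreover have "c g = g [^] card ?R" if g: "g \<in> Q" for g
  proof -
    have gc: "g \<in> carrier G" using g Q.subset by blast
    \<comment> \<open>Translation by an element of \<open>Q\<close> fixes every coset, so the two
      representatives cancel.\<close>
    have "f g U = g" if U: "U \<in> ?R" for U
    proof -
      have "l g U = U" unfolding l_def
        using Q.rcos_const[OF is_group g] Q.rcosets_mult_eq[OF U] by simp
      then show ?thesis unfolding f_def using gc t(1)[OF U] by (simp add: m_assoc)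
    qed
    then have "c g = finprod (G\<lparr>carrier := Q\<rparr>) (\<lambda>U. g) ?R"
      unfolding c_def by (intro A.finprod_cong') (use g in auto)
    also have "\<dots> = g [^] card ?R" using A.finprod_const[of g ?R] g by (simp add: nat_pow_consistent[symmetric])
    finally show ?thesis .
  qed
  ultimately show ?thesis using cQ by (intro exI[of _ c]) auto
qed

text \<open>The values are cosets of a normal subgroup of \<open>G\<close>, so every prime yields a
  group over the same type \<open>'a set\<close>, and these groups can later be multiplied
  together.\<close>

lemma ex_prime_cocycle:
  assumes fin: "finite (carrier G)" and p: "Factorial_Ring.prime p" and sol: "solvable G"
    and P: "sylow_subgroup G p P" and com: "comm_group (G\<lparr>carrier := P\<rparr>)"
  shows "\<exists>(A :: 'a set monoid) a c. prime_cocycle G p A a c"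
proof -
  have sP: "subgroup P G" and cP: "card P = p ^ multiplicity p (order G)"
    using P by (auto simp: sylow_subgroup_def)
  obtain N where N: "N \<lhd> G" "p_torsion_free G p N"
    and Nmax: "\<And>R. R \<lhd> G \<Longrightarrow> p_torsion_free G p R \<Longrightarrow> card R \<le> card N"
    using ex_max_card_normal[OF fin, of "p_torsion_free G p"] by (auto simp: p_torsion_free_def)
  interpret N: normal N G by fact
  define H where "H = G Mod N"
  define \<pi> where "\<pi> g = N #> g" for g
  interpret H: group H unfolding H_def by (rule N.factorgroup_is_group)
  interpret \<pi>: group_hom G H \<pi>
    using N.r_coset_hom_Mod is_group H.is_group unfolding H_def \<pi>_def
    by (simp add: group_hom_def group_hom_axioms_def)
  have surj: "\<pi> ` carrier G = carrier H" by (auto simp: \<pi>_def H_def carrier_FactGroup)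
  have ker: "x \<in> N" if "x \<in> carrier G" "\<pi> x = \<one>\<^bsub>H\<^esub>" for x
    using that coset_join1 N.subset N.subgroup_axioms unfolding \<pi>_def H_def by simp
  have kerN: "\<pi> x = \<one>\<^bsub>H\<^esub>" if "x \<in> N" for x
    unfolding \<pi>_def H_def using N.rcos_const[OF is_group that] by simp
  have finH: "finite (carrier H)" using fin surj by (metis finite_imageI)
  \<comment> \<open>The preimage \<open>L\<close> of a normal p'-subgroup of the quotient is a
    normal p'-subgroup of \<open>G\<close> containing \<open>N\<close>, so it equals
    \<open>N\<close> by maximality of the order.\<close>
  have no: "M = {\<one>\<^bsub>H\<^esub>}" if M: "M \<lhd> H" "p_torsion_free H p M" for M
  proof -
    interpret M: normal M H by fact
    define L where "L = {g \<in> carrier G. \<pi> g \<in> M}"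
    have "L \<lhd> G"
    proof (rule normal_invI)
      show "subgroup L G"
        by (rule subgroupI) (auto simp: L_def intro!: exI[of _ \<one>] M.m_closed M.m_inv_closed)
      show "\<And>g x. g \<in> carrier G \<Longrightarrow> x \<in> L \<Longrightarrow> g \<otimes> x \<otimes> inv g \<in> L"
        using M.inv_op_closed2 by (auto simp: L_def)
    qed
    moreover have "p_torsion_free G p L"
      unfolding p_torsion_free_def
    proof (intro ballI impI)
      fix x assume x: "x \<in> L" "x [^] p = \<one>"
      then have "\<pi> x [^]\<^bsub>H\<^esub> p = \<one>\<^bsub>H\<^esub>" using \<pi>.hom_nat_pow by (auto simp: L_def simp flip: \<pi>.hom_nat_pow)
      then have "\<pi> x = \<one>\<^bsub>H\<^esub>" using x M(2) by (auto simp: L_def p_torsion_free_def)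
      then have "x \<in> N" using x ker by (auto simp: L_def)
      then show "x = \<one>" using N(2) x by (auto simp: p_torsion_free_def)
    qed
    ultimately have "card L \<le> card N" by (rule Nmax)
    moreover have "N \<subseteq> L"
    proof
      fix x assume x: "x \<in> N"
      then have "\<pi> x = \<one>\<^bsub>H\<^esub>" by (rule kerN)
      then show "x \<in> L" using x N.subset M.one_closed by (auto simp: L_def)
    qed
    moreover have "finite L" using fin by (auto simp: L_def)
    ultimately have "N = L" by (simp add: card_seteq)
    show ?thesis
    proof
      show "{\<one>\<^bsub>H\<^esub>} \<subseteq> M" using M.one_closed by simp
      show "M \<subseteq> {\<one>\<^bsub>H\<^esub>}"
      proof
        fix y assume y: "y \<in> M"
        then obtain x where x: "x \<in> carrier G" "y = \<pi> x" using M.subset surj by blast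
        then have "x \<in> L" using y by (simp add: L_def)
        then show "y \<in> {\<one>\<^bsub>H\<^esub>}" using x \<open>N = L\<close> kerN by blast
      qed
    qed
  qed
  define Q where "Q = \<pi> ` P"
  have sQ: "subgroup Q H" unfolding Q_def using \<pi>.subgroup_img_is_subgroup[OF sP] .
  \<comment> \<open>\<open>P\<close> meets \<open>N\<close> trivially: a common element has p-power
    order, and \<open>N\<close> has no p-torsion.\<close>
  have injP: "inj_on \<pi> P"
  proof (rule inj_onI)
    fix x y assume x: "x \<in> P" and y: "y \<in> P" and eq: "\<pi> x = \<pi> y"
    have xc: "x \<in> carrier G" "y \<in> carrier G" using x y subgroup.mem_carrier[OF sP] by auto
    have "\<pi> (x \<otimes> inv y) = \<one>\<^bsub>H\<^esub>" using eq xc by simp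
    then have "x \<otimes> inv y \<in> N" using ker xc by simp
    moreover have "x \<otimes> inv y \<in> P" using x y sP by (simp add: subgroup.m_closed subgroup.m_inv_closed)
    then obtain k where "(x \<otimes> inv y) [^] (p ^ k) = \<one>"
      using p_primary_if_card[OF sP cP] unfolding p_primary_def by blast
    ultimately have "x \<otimes> inv y = \<one>"
      using p_torsion_free_pow_prime_power[OF N.subgroup_axioms N(2)] by blast
    then show "x = y" using xc by (metis inv_equality inv_inv inv_closed)
  qed
  have G0: "order G \<noteq> 0" "order H \<noteq> 0" "\<not> is_unit p"
    using fin finH order_gt_0_iff_finite H.order_gt_0_iff_finite p by auto
  have cQ: "card Q = p ^ multiplicity p (order G)" using cP injP by (simp add: Q_def card_image)
  \<comment> \<open>The p-parts of the orders of \<open>H\<close> and \<open>G\<close> agree: one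
    bound comes from divisibility, the other from the subgroup \<open>Q\<close>. Hence
    \<open>Q\<close> is a Sylow subgroup of \<open>H\<close>.\<close>
  have "order H dvd order G"
    using lagrange[OF N.subgroup_axioms] by (simp add: H_def order_def FactGroup_def) (metis dvd_triv_left)
  then have "multiplicity p (order H) \<le> multiplicity p (order G)"
    using G0 by (simp add: dvd_imp_multiplicity_le)
  moreover have "p ^ multiplicity p (order G) dvd order H"
    using H.lagrange[OF sQ] cQ by (metis dvd_triv_right)
  then have "multiplicity p (order G) \<le> multiplicity p (order H)"
    using G0 by (simp add: power_dvd_iff_le_multiplicity)
  ultimately have mult: "multiplicity p (order H) = multiplicity p (order G)" by simp
  then have sylQ: "sylow_subgroup H p Q" using sQ cQ p by (simp add: sylow_subgroup_def)
  interpret AQ: group "H\<lparr>carrier := Q\<rparr>" using H.subgroup_imp_group sQ by blast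
  have comQ: "comm_group (H\<lparr>carrier := Q\<rparr>)"
  proof (rule AQ.group_comm_groupI)
    fix x y assume "x \<in> carrier (H\<lparr>carrier := Q\<rparr>)" "y \<in> carrier (H\<lparr>carrier := Q\<rparr>)"
    then obtain u v where uv: "u \<in> P" "v \<in> P" "x = \<pi> u" "y = \<pi> v" by (auto simp: Q_def)
    have "u \<otimes> v = v \<otimes> u" using comm_groupE(4)[OF com, of u v] uv by simp
    then have "\<pi> (u \<otimes> v) = \<pi> (v \<otimes> u)" by simp
    then show "x \<otimes>\<^bsub>H\<lparr>carrier := Q\<rparr>\<^esub> y = y \<otimes>\<^bsub>H\<lparr>carrier := Q\<rparr>\<^esub> x"
      using uv subgroup.mem_carrier[OF sP] by simp
  qed
  have solH: "solvable H" using \<pi>.surj_hom_imp_solvable[OF surj sol] .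
  have nQ: "Q \<lhd> H" using H.abelian_sylow_normal[OF finH p solH no sylQ comQ] .
  interpret Q: normal Q H by (rule nQ)
  define m where "m = card (rcosets\<^bsub>H\<^esub> Q)"
  have mQ: "m * p ^ multiplicity p (order H) = order H"
    using H.lagrange[OF sQ] cQ mult by (simp add: m_def)
  \<comment> \<open>The transfer acts on \<open>Q\<close> as the power with exponent
    \<open>m\<close>, the index of \<open>Q\<close>. It is prime to \<open>p\<close> because
    \<open>Q\<close> takes up the whole p-part of the order of \<open>H\<close>.\<close>
  have pm: "coprime p m"
  proof (rule prime_imp_coprime[OF p])
    show "\<not> p dvd m"
    proof
      assume "p dvd m"
      then have "p ^ Suc (multiplicity p (order H)) dvd order H"
        using mQ by (metis mult_dvd_mono dvd_refl power_Suc)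
      then show False using G0 by (simp add: power_dvd_iff_le_multiplicity del: power_Suc)
    qed
  qed
  obtain c where c: "c \<in> carrier H \<rightarrow> Q"
    and coc: "\<And>g h. g \<in> carrier H \<Longrightarrow> h \<in> carrier H \<Longrightarrow> c (g \<otimes>\<^bsub>H\<^esub> h) = c g \<otimes>\<^bsub>H\<^esub> (g \<otimes>\<^bsub>H\<^esub> c h \<otimes>\<^bsub>H\<^esub> inv\<^bsub>H\<^esub> g)"
    and cm: "\<And>g. g \<in> Q \<Longrightarrow> c g = g [^]\<^bsub>H\<^esub> m"
    using H.ex_transfer_cocycle[OF nQ comQ] unfolding m_def by blast
  define A where "A = H\<lparr>carrier := Q\<rparr>"
  have comA: "comm_group A" using comQ by (simp add: A_def)
  let ?a = "\<lambda>g x. \<pi> g \<otimes>\<^bsub>H\<^esub> x \<otimes>\<^bsub>H\<^esub> inv\<^bsub>H\<^esub> (\<pi> g)"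
  have Qc: "x \<in> carrier H" if "x \<in> Q" for x using that Q.subset by blast
  have act: "?a g \<in> hom A A" "inj_on (?a g) (carrier A)" if g: "g \<in> carrier G" for g
  proof -
    show "?a g \<in> hom A A"
      using Q.inv_op_closed2 g Qc by (auto simp: A_def hom_def H.conj_mult)
    show "inj_on (?a g) (carrier A)"
      by (rule inj_onI) (use g Qc in \<open>simp add: A_def\<close>)
  qed
  \<comment> \<open>\<open>\<pi> g\<close> is annihilated by \<open>p\<close>, and its image in
    \<open>H Mod Q\<close> also by the coprime index \<open>m\<close>, so \<open>\<pi> g\<close>
    lies in \<open>Q\<close>. There \<open>c\<close> is the \<open>m\<close>-th power, so
    \<open>\<pi> g\<close> is trivial and \<open>g\<close> falls into \<open>N\<close>, which has no
    p-torsion.\<close>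
  have triv: "g = \<one>" if g: "g \<in> carrier G" and c1: "c (\<pi> g) = \<one>\<^bsub>H\<^esub>" and gp: "g [^] p = \<one>" for g
  proof -
    interpret F: group "H Mod Q" by (rule Q.factorgroup_is_group)
    have hp: "\<pi> g [^]\<^bsub>H\<^esub> p = \<one>\<^bsub>H\<^esub>" using g gp by (simp flip: \<pi>.hom_nat_pow)
    have h: "\<pi> g \<in> carrier H" using g by simp
    have carF: "Q #>\<^bsub>H\<^esub> \<pi> g \<in> carrier (H Mod Q)" using h by (simp add: carrier_FactGroup)
    have "(Q #>\<^bsub>H\<^esub> \<pi> g) [^]\<^bsub>H Mod Q\<^esub> p = \<one>\<^bsub>H Mod Q\<^esub>"
      using Q.FactGroup_pow[OF h, of p] hp Q.subset by simp
    moreover have "(Q #>\<^bsub>H\<^esub> \<pi> g) [^]\<^bsub>H Mod Q\<^esub> m = \<one>\<^bsub>H Mod Q\<^esub>"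
      using F.pow_order_eq_1[OF carF] by (simp add: m_def order_def FactGroup_def)
    ultimately have "Q #>\<^bsub>H\<^esub> \<pi> g = Q" using F.pow_coprime_eq_one[OF carF _ _ pm] by simp
    then have hQ: "\<pi> g \<in> Q" using H.coset_join1[OF _ h sQ] by blast
    then have "\<pi> g [^]\<^bsub>H\<^esub> m = \<one>\<^bsub>H\<^esub>" using cm c1 by simp
    then have "\<pi> g = \<one>\<^bsub>H\<^esub>" using H.pow_coprime_eq_one[OF h hp _ pm] by blast
    then have "g \<in> N" using ker g by blast
    then show ?thesis using N(2) gp by (auto simp: p_torsion_free_def)
  qed
  show ?thesis
  proof (rule exI[of _ A], rule exI[of _ ?a], rule exI[of _ "\<lambda>g. c (\<pi> g)"],
      unfold prime_cocycle_def, intro conjI ballI impI)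
    show "comm_group A" by fact
    show "card (carrier A) = p ^ multiplicity p (order G)" using cQ by (simp add: A_def)
    show "(\<lambda>g. c (\<pi> g)) \<in> carrier G \<rightarrow> carrier A"
      using c funcset_mem[OF c] by (auto simp: A_def)
  next
    fix g h assume "g \<in> carrier G" "h \<in> carrier G"
    then show "c (\<pi> (g \<otimes> h)) = c (\<pi> g) \<otimes>\<^bsub>A\<^esub> ?a g (c (\<pi> h))"
      using coc[of "\<pi> g" "\<pi> h"] by (simp add: A_def)
  next
    fix g assume "g \<in> carrier G" "c (\<pi> g) = \<one>\<^bsub>A\<^esub>" "g [^] p = \<one>"
    then show "g = \<one>" using triv by (simp add: A_def)
  next
    fix g assume g: "g \<in> carrier G"
    show "?a g \<in> hom A A" "inj_on (?a g) (carrier A)" using act[OF g] .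
  qed
qed

end

section \<open>Braces from bijective cocycles\<close>

text \<open>\<open>G\<close> itself serves as the multiplicative group. Under \<open>c\<close> both
  sides of the brace identity become the product of two copies of \<open>c g\<close> with
  \<open>a g (c h)\<close> and \<open>a g (c k)\<close>, up to order.\<close>

lemma IYB_group_if_bijective_cocycle:
  fixes G :: "'a monoid" and A :: "('b, 'c) monoid_scheme"
  assumes "group G" "finite (carrier G)" "comm_group A"
    and act: "\<And>g. g \<in> carrier G \<Longrightarrow> a g \<in> hom A A"
    and bij: "bij_betw c (carrier G) (carrier A)"
    and coc: "\<And>g h. g \<in> carrier G \<Longrightarrow> h \<in> carrier G \<Longrightarrow> c (g \<otimes>\<^bsub>G\<^esub> h) = c g \<otimes>\<^bsub>A\<^esub> a g (c h)"
  shows "IYB_group G"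
proof -
  interpret G: group G by fact
  interpret A: comm_group A by fact
  define d where "d = inv_into (carrier G) c"
  have d: "d x \<in> carrier G" "c (d x) = x" if "x \<in> carrier A" for x
    using that bij unfolding d_def by (auto simp: bij_betw_def inv_into_into f_inv_into_f)
  have dc: "d (c g) = g" if "g \<in> carrier G" for g
    using that bij unfolding d_def by (simp add: bij_betw_def)
  have c: "c g \<in> carrier A" if "g \<in> carrier G" for g
    using that bij by (auto simp: bij_betw_def)
  have ac: "a g x \<in> carrier A" if "g \<in> carrier G" "x \<in> carrier A" for g x
    using act[OF that(1)] that(2) by (auto simp: hom_def)
  define B where "B = \<lparr>carrier = carrier G, monoid.mult = (\<lambda>x y. d (c x \<otimes>\<^bsub>A\<^esub> c y)), one = d \<one>\<^bsub>A\<^esub>\<rparr>"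
  have "comm_group B"
  proof (rule comm_groupI)
    fix x assume "x \<in> carrier B"
    then have x: "x \<in> carrier G" by (simp add: B_def)
    show "\<exists>y\<in>carrier B. y \<otimes>\<^bsub>B\<^esub> x = \<one>\<^bsub>B\<^esub>"
      by (rule bexI[of _ "d (inv\<^bsub>A\<^esub> (c x))"]) (use x c d in \<open>auto simp: B_def\<close>)
  qed (use c d dc in \<open>auto simp: B_def A.m_assoc A.m_comm A.m_lcomm\<close>)
  moreover have "(g \<otimes>\<^bsub>G\<^esub> (h \<otimes>\<^bsub>B\<^esub> k)) \<otimes>\<^bsub>B\<^esub> g = (g \<otimes>\<^bsub>G\<^esub> h) \<otimes>\<^bsub>B\<^esub> (g \<otimes>\<^bsub>G\<^esub> k)"
    if g: "g \<in> carrier G" "h \<in> carrier G" "k \<in> carrier G" for g h k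
  proof -
    have "a g (c h \<otimes>\<^bsub>A\<^esub> c k) = a g (c h) \<otimes>\<^bsub>A\<^esub> a g (c k)"
      using act[OF g(1)] c g by (simp add: hom_mult)
    then have "c (g \<otimes>\<^bsub>G\<^esub> (h \<otimes>\<^bsub>B\<^esub> k)) \<otimes>\<^bsub>A\<^esub> c g = c (g \<otimes>\<^bsub>G\<^esub> h) \<otimes>\<^bsub>A\<^esub> c (g \<otimes>\<^bsub>G\<^esub> k)"
      using g c d ac by (simp add: coc B_def A.m_assoc A.m_comm A.m_lcomm)
    then show ?thesis by (simp add: B_def)
  qed
  ultimately have "left_brace B G"
    using G.is_group by (simp add: left_brace_def) (simp add: B_def)
  then show ?thesis
    using assms(2) iso_refl unfolding IYB_group_def by blast
qed

section \<open>The product over the primes dividing the order\<close>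

theorem theorem2p1:
  fixes G :: "'a monoid"
  assumes "group G"
    and "finite (carrier G)"
    and "solvable G"
    and "\<And>p P. sylow_subgroup G p P \<Longrightarrow> comm_group (G\<lparr>carrier := P\<rparr>)"
  shows "IYB_group G"
proof -
  interpret G: group G by fact
  let ?I = "prime_factors (order G)"
  have G0: "order G \<noteq> 0" using assms(2) G.order_gt_0_iff_finite by simp
  have "\<exists>(A :: 'a set monoid) a c. prime_cocycle G p A a c"
    if "p \<in> ?I" for p
  proof -
    have p: "Factorial_Ring.prime p" using that by auto
    obtain m where "order G = p ^ multiplicity p (order G) * m"
      using multiplicity_dvd dvdE by metis
    from sylow_thm[OF p assms(1) this assms(2)]
    obtain P where "subgroup P G" "card P = p ^ multiplicity p (order G)" by blast
    then have "sylow_subgroup G p P" using p by (simp add: sylow_subgroup_def)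
    then show ?thesis using G.ex_prime_cocycle[OF assms(2) p assms(3)] assms(4) by blast
  qed
  then obtain A :: "nat \<Rightarrow> 'a set monoid" and a c where
    "\<And>p. p \<in> ?I \<Longrightarrow> prime_cocycle G p (A p) (a p) (c p)"
    by metis
  then have com: "\<And>p. p \<in> ?I \<Longrightarrow> comm_group (A p)"
    and cA: "\<And>p. p \<in> ?I \<Longrightarrow> card (carrier (A p)) = p ^ multiplicity p (order G)"
    and act: "\<And>p g. p \<in> ?I \<Longrightarrow> g \<in> carrier G \<Longrightarrow> a p g \<in> hom (A p) (A p)"
    and inj: "\<And>p g. p \<in> ?I \<Longrightarrow> g \<in> carrier G \<Longrightarrow> inj_on (a p g) (carrier (A p))"
    and c: "\<And>p g. p \<in> ?I \<Longrightarrow> g \<in> carrier G \<Longrightarrow> c p g \<in> carrier (A p)"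
    and coc: "\<And>p g h. p \<in> ?I \<Longrightarrow> g \<in> carrier G \<Longrightarrow> h \<in> carrier G \<Longrightarrow>
      c p (g \<otimes>\<^bsub>G\<^esub> h) = c p g \<otimes>\<^bsub>A p\<^esub> a p g (c p h)"
    and triv: "\<And>p g. p \<in> ?I \<Longrightarrow> g \<in> carrier G \<Longrightarrow> c p g = \<one>\<^bsub>A p\<^esub> \<Longrightarrow>
      g [^]\<^bsub>G\<^esub> p = \<one>\<^bsub>G\<^esub> \<Longrightarrow> g = \<one>\<^bsub>G\<^esub>"
    unfolding prime_cocycle_def by blast+
  have grp: "group (A p)" if "p \<in> ?I" for p using com[OF that] comm_group.axioms(2) by blast
  let ?A = "product_group ?I A"
  \<comment> \<open>Carrier elements of \<open>product_group\<close> are extensional functions, so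
    both maps are restricted to the index set.\<close>
  let ?a = "\<lambda>g x. \<lambda>p\<in>?I. a p g (x p)"
  let ?c = "\<lambda>g. \<lambda>p\<in>?I. c p g"
  have a_one: "a p g \<one>\<^bsub>A p\<^esub> = \<one>\<^bsub>A p\<^esub>" if "p \<in> ?I" "g \<in> carrier G" for p g
    using hom_one[OF act[OF that] grp grp] that by blast
  \<comment> \<open>For exponent 0 the value at the unit is found by cancelling in the cocycle
    identity for \<open>g \<otimes> \<one>\<close> and using injectivity of
    \<open>a p g\<close>.\<close>
  have ker_pow: "c p (g [^]\<^bsub>G\<^esub> (n::nat)) = \<one>\<^bsub>A p\<^esub>"
    if p: "p \<in> ?I" and g: "g \<in> carrier G" and cg: "c p g = \<one>\<^bsub>A p\<^esub>" for p g n
  proof (induction n)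
    interpret Ap: group "A p" using grp p .
    case 0
    have "c p (g \<otimes>\<^bsub>G\<^esub> \<one>\<^bsub>G\<^esub>) = c p g \<otimes>\<^bsub>A p\<^esub> a p g (c p \<one>\<^bsub>G\<^esub>)" using coc p g by blast
    moreover have ac: "a p g (c p \<one>\<^bsub>G\<^esub>) \<in> carrier (A p)"
      using act[OF p g] c[OF p G.one_closed] by (auto simp: hom_def)
    ultimately have "a p g (c p \<one>\<^bsub>G\<^esub>) = a p g \<one>\<^bsub>A p\<^esub>"
      using cg g a_one[OF p g] by simp
    then have "c p \<one>\<^bsub>G\<^esub> = \<one>\<^bsub>A p\<^esub>"
      using inj_onD[OF inj[OF p g]] c[OF p G.one_closed] by blast
    then show ?case by simp
  next
    interpret Ap: group "A p" using grp p .
    case (Suc n)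
    then show ?case using coc[OF p _ g, of "g [^]\<^bsub>G\<^esub> n"] g cg a_one[OF p] by simp
  qed
  have comA: "comm_group ?A"
  proof (rule group.group_comm_groupI)
    show "group ?A" using grp by simp
    fix x y assume x: "x \<in> carrier ?A" "y \<in> carrier ?A"
    show "x \<otimes>\<^bsub>?A\<^esub> y = y \<otimes>\<^bsub>?A\<^esub> x"
      unfolding mult_product_group
    proof (rule restrict_ext)
      fix p assume p: "p \<in> ?I"
      then show "x p \<otimes>\<^bsub>A p\<^esub> y p = y p \<otimes>\<^bsub>A p\<^esub> x p"
        using comm_groupE(4)[OF com[OF p]] x by (auto simp: PiE_iff)
    qed
  qed
  have injc: "inj_on ?c (carrier G)"
  proof (rule inj_onI)
    fix g h assume g: "g \<in> carrier G" and h: "h \<in> carrier G" and eq: "?c g = ?c h"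
    define k where "k = inv\<^bsub>G\<^esub> g \<otimes>\<^bsub>G\<^esub> h"
    have k: "k \<in> carrier G" using g h by (simp add: k_def)
    have hk: "h = g \<otimes>\<^bsub>G\<^esub> k" using g h by (simp add: k_def G.inv_mult_cancel)
    \<comment> \<open>Equal values at \<open>g\<close> and \<open>h = g \<otimes> k\<close> leave
      \<open>a p g (c p k) = \<one>\<close>.\<close>
    have ck: "c p k = \<one>\<^bsub>A p\<^esub>" if p: "p \<in> ?I" for p
    proof -
      interpret Ap: group "A p" using grp p .
      have "c p g = c p h" using eq p by (metis restrict_apply')
      then have "c p g = c p g \<otimes>\<^bsub>A p\<^esub> a p g (c p k)" using coc[OF p g k] hk by simp
      moreover have "a p g (c p k) \<in> carrier (A p)"
        using act[OF p g] c[OF p k] by (auto simp: hom_def)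
      ultimately have "a p g (c p k) = a p g \<one>\<^bsub>A p\<^esub>"
        using c[OF p g] a_one[OF p g] by (metis Ap.l_cancel_one')
      then show ?thesis using inj_onD[OF inj[OF p g]] c[OF p k] by blast
    qed
    have "k = \<one>\<^bsub>G\<^esub>"
    proof (rule ccontr)
      assume "k \<noteq> \<one>\<^bsub>G\<^esub>"
      then have "G.ord k \<noteq> 1" using k G.ord_eq_1 by blast
      then obtain p where p: "Factorial_Ring.prime p" "p dvd G.ord k" using prime_factor_nat by blast
      \<comment> \<open>\<open>n\<close> is the order of \<open>k\<close> divided by
        \<open>p\<close>, so \<open>k [^] n\<close> has order \<open>p\<close> and lies in the
        kernel of \<open>c p\<close>. As \<open>c p\<close> kills no such element, the order of
        \<open>k\<close> would divide \<open>n\<close>.\<close>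
      then obtain n where n: "G.ord k = p * n" by blast
      have pI: "p \<in> ?I"
        using p G0 G.ord_dvd_group_order[OF k] by (auto simp: in_prime_factors_iff intro: dvd_trans)
      have "(k [^]\<^bsub>G\<^esub> n) [^]\<^bsub>G\<^esub> p = \<one>\<^bsub>G\<^esub>"
        using G.pow_ord_eq_1[OF k] n k by (simp add: G.nat_pow_pow mult.commute)
      then have "k [^]\<^bsub>G\<^esub> n = \<one>\<^bsub>G\<^esub>"
        using triv[OF pI, of "k [^]\<^bsub>G\<^esub> n"] ker_pow[OF pI k ck[OF pI]] k by simp
      then have "p * n dvd n" using G.pow_eq_id[OF k] n by metis
      moreover have "n \<noteq> 0" using n G.ord_ge_1[OF assms(2) k] by auto
      ultimately show False using p(1) by (auto dest!: dvd_imp_le simp: prime_nat_iff)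
    qed
    then show "g = h" using hk g by simp
  qed
  have "bij_betw ?c (carrier G) (carrier ?A)"
  proof -
    have sub: "?c ` carrier G \<subseteq> carrier ?A" using c by auto
    \<comment> \<open>The p-parts multiply up to the order of \<open>G\<close>, so the injection
      \<open>?c\<close> runs between finite sets of equal size.\<close>
    have "card (carrier ?A) = (\<Prod>p\<in>?I. p ^ multiplicity p (order G))"
      using cA by (simp add: card_PiE)
    also have "\<dots> = order G" using G0 prime_factorization_nat by simp
    finally have "card (carrier ?A) = order G" .
    moreover have "card (?c ` carrier G) = order G" using injc by (simp add: card_image order_def)
    moreover have "finite (carrier ?A)"
      using \<open>card (carrier ?A) = order G\<close> G0 by (metis card.infinite)
    ultimately have "?c ` carrier G = carrier ?A" using sub by (simp add: card_subset_eq)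
    then show ?thesis using injc by (simp add: bij_betw_def)
  qed
  moreover have "?a g \<in> hom ?A ?A" if g: "g \<in> carrier G" for g
  proof (rule homI)
    fix x assume "x \<in> carrier ?A"
    then show "?a g x \<in> carrier ?A" using act[OF _ g] by (auto simp: PiE_iff hom_def Pi_iff)
  next
    fix x y assume xy: "x \<in> carrier ?A" "y \<in> carrier ?A"
    have "a p g (x p \<otimes>\<^bsub>A p\<^esub> y p) = a p g (x p) \<otimes>\<^bsub>A p\<^esub> a p g (y p)" if p: "p \<in> ?I" for p
      using hom_mult[OF act[OF p g]] xy p by (auto simp: PiE_iff)
    then show "?a g (x \<otimes>\<^bsub>?A\<^esub> y) = ?a g x \<otimes>\<^bsub>?A\<^esub> ?a g y"
      unfolding mult_product_group by (intro restrict_ext) simp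
  qed
  moreover have "?c (g \<otimes>\<^bsub>G\<^esub> h) = ?c g \<otimes>\<^bsub>?A\<^esub> ?a g (?c h)" if "g \<in> carrier G" "h \<in> carrier G" for g h
    unfolding mult_product_group by (rule restrict_ext) (simp add: coc that)
  ultimately show ?thesis
    using IYB_group_if_bijective_cocycle[OF assms(1,2) comA, of ?a ?c] by blast
qed

end
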